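(* Let $K$ be a finite simplicial complex, let $F$ be an acyclic discrete vector field on $K$, and suppose the arrow $\alpha^{(p)}\to\beta^{(p+1)}$ is added to $F$ naturally, giving the acyclic discrete vector field $F'=F\sqcup\{\alpha\to\beta\}$. Then no new paths ending at $\alpha$ are created, and no new paths starting at $\beta$ are created (i.e. no $F'$-path that is not an $F$-path ends at $\alpha$ or starts at $\beta$). Additionally, for any $\tau^{(p+1)}\neq\beta$ and $\sigma^{(p)}\neq\alpha$ in $K$, the number of paths from $\tau$ to $\sigma$ increases by $\Gamma(\tau,\alpha)\,\Gamma(\beta,\sigma)$, i.e. $$\Gamma_{F'}(\tau,\sigma)=\Gamma_F(\tau,\sigma)+\Gamma_F(\tau,\alpha)\,\Gamma_F(\beta,\sigma).$$
   Context: Superscripts denote dimension; simplices are nonempty; $\alpha<\beta$ means $\alpha$ is a proper face of $\beta$. A discrete vector field $F$ on $K$ is a collection of pairs (arrows) $\{\alpha^{(p)}\to\beta^{(p+1)}\}$ with $\alpha<\beta$ and no simplex in more than one pair. An $F$-path starting at a $p$-simplex is a sequence $\alpha_0^{(p)},\beta_0^{(p+1)},\alpha_1^{(p)},\dots,\beta_r^{(p+1)},\alpha_{r+1}^{(p)}$ with $\{\alpha_i\to\beta_i\}\in F$, $\alpha_{i+1}<\beta_i$, and $\alpha_i\ne\alpha_{i+1}$ for each $i$; it is nontrivial if $r\ge0$ and closed if $\alpha_0=\alpha_{r+1}$. $F$ is acyclic if it has no nontrivial closed $F$-paths. An $F$-path starting at a $(p+1)$-simplex is a sequence $\tau=\beta_0>\alpha_1\to\beta_1>\alpha_2\to\dots\to\beta_r>\alpha_{r+1}=\sigma$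 with $r\ge0$, where the $\beta_i$ are $(p+1)$-simplices, the $\alpha_i$ are $p$-simplices, $\alpha_{i+1}<\beta_i$ for $0\le i\le r$, $\{\alpha_i\to\beta_i\}\in F$ and $\alpha_{i}\ne\alpha_{i+1}$ for $1\le i\le r$, and $\beta_i\ne\beta_{i+1}$ for $0\le i<r$ (so a path may not start $\beta_0>\alpha_1\to\beta_0$). In particular a codimension-1 face relation $\tau>\sigma$ is itself a path ($r=0$), whether or not $\{\sigma\to\tau\}\in F$. $\Gamma_F(\tau,\sigma)$ is the number of $F$-paths from the $(p+1)$-simplex $\tau$ to the $p$-simplex $\sigma$. Adding an arrow $\alpha\to\beta$ to an acyclic discrete vector field $F$ occurs naturally if $F'=F\sqcup\{\alpha\to\beta\}$ (disjoint union) is an acyclic discrete vector field; in particular neither $\alpha$ nor $\beta$ is in any arrow of $F$. *)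

theory Defs
  imports Main
begin

type_synonym 'a simplex = "'a set"

text \<open>
  Abstract simplicial complexes: a simplex is the nonempty finite set of its vertices, so that
  being a proper face is \<open>\<subset>\<close>.  The complex itself does not contain the empty simplex.
\<close>

definition finite_simplicial_complex :: "'a simplex set \<Rightarrow> bool" where
  "finite_simplicial_complex K \<longleftrightarrow>
     finite K \<and>
     (\<forall>\<sigma>\<in>K. finite \<sigma> \<and> \<sigma> \<noteq> {}) \<and>
     (\<forall>\<sigma>\<in>K. \<forall>\<rho>. \<rho> \<noteq> {} \<and> \<rho> \<subseteq> \<sigma> \<longrightarrow> \<rho> \<in> K)"

definition simplices :: "'a simplex set \<Rightarrow> nat \<Rightarrow> 'a simplex set" where
  "simplices K p = {\<sigma> \<in> K. card \<sigma> = p + 1}"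

definition discrete_vector_field ::
    "'a simplex set \<Rightarrow> ('a simplex \<times> 'a simplex) set \<Rightarrow> bool" where
  "discrete_vector_field K F \<longleftrightarrow>
     (\<forall>(\<alpha>, \<beta>)\<in>F. \<exists>p. \<alpha> \<in> simplices K p \<and> \<beta> \<in> simplices K (p + 1) \<and> \<alpha> \<subset> \<beta>) \<and>
     (\<forall>(\<alpha>, \<beta>)\<in>F. \<forall>(\<alpha>', \<beta>')\<in>F. (\<alpha>, \<beta>) \<noteq> (\<alpha>', \<beta>') \<longrightarrow> {\<alpha>, \<beta>} \<inter> {\<alpha>', \<beta>'} = {})"

text \<open>
  A path starting at a \<open>p\<close>-simplex, \<open>\<alpha>\<^sub>0 \<rightarrow> \<beta>\<^sub>0 > \<alpha>\<^sub>1 \<rightarrow> \<dots> \<rightarrow> \<beta>\<^sub>r > \<alpha>\<^sub>r\<^sub>+\<^sub>1\<close>, is given by the two lists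
  \<open>[\<alpha>\<^sub>0, \<dots>, \<alpha>\<^sub>r\<^sub>+\<^sub>1]\<close> and \<open>[\<beta>\<^sub>0, \<dots>, \<beta>\<^sub>r]\<close>.  The trivial path consisting of \<open>\<alpha>\<^sub>0\<close> alone is the case
  where the second list is empty.
\<close>

definition lower_path ::
    "'a simplex set \<Rightarrow> ('a simplex \<times> 'a simplex) set \<Rightarrow> nat \<Rightarrow>
     'a simplex list \<Rightarrow> 'a simplex list \<Rightarrow> bool" where
  "lower_path K F p \<alpha>s \<beta>s \<longleftrightarrow>
     length \<alpha>s = length \<beta>s + 1 \<and>
     set \<alpha>s \<subseteq> simplices K p \<and> set \<beta>s \<subseteq> simplices K (p + 1) \<and>
     (\<forall>i < length \<beta>s. (\<alpha>s ! i, \<beta>s ! i) \<in> F \<and> \<alpha>s ! (i + 1) \<subset> \<beta>s ! i \<and> \<alpha>s ! i \<noteq> \<alpha>s ! (i + 1))"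

definition acyclic_discrete_vector_field ::
    "'a simplex set \<Rightarrow> ('a simplex \<times> 'a simplex) set \<Rightarrow> bool" where
  "acyclic_discrete_vector_field K F \<longleftrightarrow>
     discrete_vector_field K F \<and>
     (\<nexists>p \<alpha>s \<beta>s. lower_path K F p \<alpha>s \<beta>s \<and> \<beta>s \<noteq> [] \<and> hd \<alpha>s = last \<alpha>s)"

text \<open>
  A path starting at a \<open>(p+1)\<close>-simplex, \<open>\<beta>\<^sub>0 > \<alpha>\<^sub>1 \<rightarrow> \<beta>\<^sub>1 > \<alpha>\<^sub>2 \<rightarrow> \<dots> \<rightarrow> \<beta>\<^sub>r > \<alpha>\<^sub>r\<^sub>+\<^sub>1\<close> with \<open>r \<ge> 0\<close>, is given
  by the two lists \<open>[\<beta>\<^sub>0, \<dots>, \<beta>\<^sub>r]\<close> and \<open>[\<alpha>\<^sub>1, \<dots>, \<alpha>\<^sub>r\<^sub>+\<^sub>1]\<close>.  Note the shift: \<open>\<alpha>s ! i\<close> is \<open>\<alpha>\<^sub>i\<^sub>+\<^sub>1\<close>.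
\<close>

definition upper_path ::
    "'a simplex set \<Rightarrow> ('a simplex \<times> 'a simplex) set \<Rightarrow> nat \<Rightarrow>
     'a simplex list \<Rightarrow> 'a simplex list \<Rightarrow> bool" where
  "upper_path K F p \<beta>s \<alpha>s \<longleftrightarrow>
     \<beta>s \<noteq> [] \<and> length \<alpha>s = length \<beta>s \<and>
     set \<beta>s \<subseteq> simplices K (p + 1) \<and> set \<alpha>s \<subseteq> simplices K p \<and>
     (\<forall>i < length \<beta>s. \<alpha>s ! i \<subset> \<beta>s ! i) \<and>
     (\<forall>i. i + 1 < length \<beta>s \<longrightarrow>
        (\<alpha>s ! i, \<beta>s ! (i + 1)) \<in> F \<and> \<alpha>s ! i \<noteq> \<alpha>s ! (i + 1) \<and> \<beta>s ! i \<noteq> \<beta>s ! (i + 1))"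

text \<open>
  The set counted here is finite when \<open>K\<close> is finite and \<open>F\<close> is acyclic, the only case in which
  the number is used.
\<close>

definition num_paths ::
    "'a simplex set \<Rightarrow> ('a simplex \<times> 'a simplex) set \<Rightarrow> 'a simplex \<Rightarrow> 'a simplex \<Rightarrow> nat" where
  "num_paths K F \<tau> \<sigma> =
     card {(\<beta>s, \<alpha>s). (\<exists>p. upper_path K F p \<beta>s \<alpha>s) \<and> hd \<beta>s = \<tau> \<and> last \<alpha>s = \<sigma>}"

definition added_naturally ::
    "'a simplex set \<Rightarrow> ('a simplex \<times> 'a simplex) set \<Rightarrow> 'a simplex \<Rightarrow> 'a simplex \<Rightarrow> bool" where
  "added_naturally K F \<alpha> \<beta> \<longleftrightarrow>
     (\<alpha>, \<beta>) \<notin> F \<and> acyclic_discrete_vector_field K (F \<union> {(\<alpha>, \<beta>)})"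

end

theory Submission
  imports Defs
begin

text \<open>
  In an acyclic field no path visits a lower simplex twice, so a path that ends at \<open>\<alpha>\<close> or starts at
  \<open>\<beta>\<close> cannot traverse the new arrow.  Consequently every path that does traverse it does so exactly
  once, and cutting it there yields an old path ending at \<open>\<alpha>\<close> and an old path starting at \<open>\<beta>\<close>.
  Conversely any two such paths can be joined: the conditions at the junction hold because
  \<open>\<alpha>\<close> and \<open>\<beta>\<close> lie in no other arrow.
\<close>

section \<open>Paths in an acyclic field: no repetition, concatenation, finiteness\<close>

definition upper_paths ::
    "'a simplex set \<Rightarrow> ('a simplex \<times> 'a simplex) set \<Rightarrow> 'a simplex \<Rightarrow> 'a simplex \<Rightarrow>
     ('a simplex list \<times> 'a simplex list) set" where
  "upper_paths K F \<tau> \<sigma> =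
     {(\<beta>s, \<alpha>s). (\<exists>p. upper_path K F p \<beta>s \<alpha>s) \<and> hd \<beta>s = \<tau> \<and> last \<alpha>s = \<sigma>}"

lemma lower_path_drop:
  assumes "lower_path K F p \<alpha>s \<beta>s" "i \<le> length \<beta>s"
  shows "lower_path K F p (drop i \<alpha>s) (drop i \<beta>s)"
  using assms set_drop_subset[of i \<alpha>s] set_drop_subset[of i \<beta>s] unfolding lower_path_def
  by (simp add: Suc_diff_le) blast

lemma lower_path_take:
  assumes "lower_path K F p \<alpha>s \<beta>s" "i \<le> length \<beta>s"
  shows "lower_path K F p (take (Suc i) \<alpha>s) (take i \<beta>s)"
  using assms set_take_subset[of "Suc i" \<alpha>s] set_take_subset[of i \<beta>s] unfolding lower_path_def
  by (simp add: min_absorb2) (meson less_le_trans subset_trans)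

text \<open>Between two occurrences of the same simplex lies a nontrivial closed path.\<close>

lemma distinct_lower_path:
  assumes acyc: "acyclic_discrete_vector_field K F" and path: "lower_path K F p \<alpha>s \<beta>s"
  shows "distinct \<alpha>s"
proof (rule ccontr)
  have len: "length \<alpha>s = Suc (length \<beta>s)"
    using path by (simp add: lower_path_def)
  assume "\<not> distinct \<alpha>s"
  then obtain i j where ij: "i < j" "j < length \<alpha>s" "\<alpha>s ! i = \<alpha>s ! j"
    unfolding distinct_conv_nth by (metis linorder_neqE_nat)
  \<comment> \<open>The segment keeps both copies of the repeated simplex, hence one more lower
    simplex than upper ones.\<close>
  let ?\<alpha>s = "take (Suc (j - i)) (drop i \<alpha>s)" and ?\<beta>s = "take (j - i) (drop i \<beta>s)"
  have "lower_path K F p ?\<alpha>s ?\<beta>s"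
    using path ij len by (intro lower_path_take lower_path_drop) auto
  moreover have "?\<beta>s \<noteq> []"
    using ij len by auto
  moreover have "hd ?\<alpha>s = last ?\<alpha>s"
    using ij by (simp add: hd_drop_conv_nth last_conv_nth min_absorb2)
  ultimately show False
    using acyc unfolding acyclic_discrete_vector_field_def by blast
qed

text \<open>Acyclicity speaks only of paths from lower simplices; forgetting the starting upper
  simplex makes it applicable.\<close>

lemma lower_path_tl_upper_path:
  assumes "upper_path K F p \<beta>s \<alpha>s"
  shows "lower_path K F p \<alpha>s (tl \<beta>s)"
  using assms unfolding upper_path_def lower_path_def
  by (auto simp: nth_tl dest: list.set_sel(2))

lemma distinct_upper_path:
  assumes "acyclic_discrete_vector_field K F" "upper_path K F p \<beta>s \<alpha>s"
  shows "distinct \<alpha>s"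
  using assms distinct_lower_path lower_path_tl_upper_path by blast

text \<open>Serves to show that a path out of the head of an arrow never comes back to its tail: the
  prefixed path falls under \<open>distinct_lower_path\<close>.\<close>

lemma lower_path_Cons_upper_path:
  assumes "upper_path K F p \<beta>s \<alpha>s" "(\<alpha>, hd \<beta>s) \<in> F" "\<alpha> \<in> simplices K p" "\<alpha> \<noteq> hd \<alpha>s"
  shows "lower_path K F p (\<alpha> # \<alpha>s) \<beta>s"
proof -
  obtain a as b bs where "\<alpha>s = a # as" "\<beta>s = b # bs"
    using assms(1) unfolding upper_path_def by (metis length_0_conv neq_Nil_conv)
  then show ?thesis
    using assms unfolding upper_path_def lower_path_def by (simp add: All_less_Suc2)
qed

text \<open>Recursive form of the index-based definition, for induction. The split on
  \<open>bs\<close> is there because a pair of empty lists is not a path.\<close>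

lemma upper_path_Cons:
  "upper_path K F p (b # bs) (a # as) \<longleftrightarrow>
     b \<in> simplices K (p + 1) \<and> a \<in> simplices K p \<and> a \<subset> b \<and>
     (if bs = [] then as = []
      else upper_path K F p bs as \<and> (a, hd bs) \<in> F \<and> a \<noteq> hd as \<and> b \<noteq> hd bs)"
proof (cases bs)
  case (Cons b' bs')
  then show ?thesis
    unfolding upper_path_def by (cases as) (simp, simp add: All_less_Suc2, blast)
qed (auto simp: upper_path_def)

text \<open>Serves both to cut and to join. Each condition on a path involves at most two
  neighbouring indices, so only those at the junction link the pieces.\<close>

lemma upper_path_append:
  assumes "length a1 = length b1" "b1 \<noteq> []" "b2 \<noteq> []"
  shows "upper_path K F p (b1 @ b2) (a1 @ a2) \<longleftrightarrow>
     upper_path K F p b1 a1 \<and> upper_path K F p b2 a2 \<and>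
     (last a1, hd b2) \<in> F \<and> last a1 \<noteq> hd a2 \<and> last b1 \<noteq> hd b2"
  using assms(1,2)
proof (induction a1 b1 rule: list_induct2)
  case (Cons a as b bs)
  show ?case
  proof (cases "bs = []")
    case True
    then have "as = []"
      using Cons.hyps by simp
    then show ?thesis
      using True assms(3) by (simp add: upper_path_Cons conj_ac)
  next
    case False
    then have "as \<noteq> []"
      using Cons.hyps by auto
    then show ?thesis
      using False Cons.IH by (simp add: upper_path_Cons conj_ac)
  qed
qed simp

lemma upper_path_mono:
  assumes "upper_path K F p \<beta>s \<alpha>s" "F \<subseteq> F'"
  shows "upper_path K F' p \<beta>s \<alpha>s"
  using assms unfolding upper_path_def by blast

text \<open>Enlarging the field relaxes only arrow membership, so the condition that fails for
  \<open>F\<close> must be met by the added pair.\<close>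

lemma upper_path_insertE:
  assumes "upper_path K (insert (\<alpha>, \<beta>) F) p \<beta>s \<alpha>s" "\<not> upper_path K F p \<beta>s \<alpha>s"
  obtains i where "i + 1 < length \<beta>s" "\<alpha>s ! i = \<alpha>" "\<beta>s ! (i + 1) = \<beta>"
  using assms unfolding upper_path_def by blast

text \<open>The lower simplices of a path are distinct, so \<open>card K\<close> bounds the length
  of both lists.\<close>

lemma finite_upper_paths:
  assumes fin: "finite K" and acyc: "acyclic_discrete_vector_field K F"
  shows "finite (upper_paths K F \<tau> \<sigma>)"
proof -
  let ?L = "{xs. set xs \<subseteq> K \<and> length xs \<le> card K}"
  have "upper_paths K F \<tau> \<sigma> \<subseteq> ?L \<times> ?L"
  proof clarify
    fix \<beta>s \<alpha>s assume "(\<beta>s, \<alpha>s) \<in> upper_paths K F \<tau> \<sigma>"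
    then obtain p where path: "upper_path K F p \<beta>s \<alpha>s"
      by (auto simp: upper_paths_def)
    then have sub: "set \<alpha>s \<subseteq> K" "set \<beta>s \<subseteq> K" and len: "length \<beta>s = length \<alpha>s"
      by (auto simp: upper_path_def simplices_def)
    have "length \<alpha>s \<le> card K"
      using distinct_upper_path[OF acyc path] card_mono[OF fin sub(1)]
      by (simp add: distinct_card)
    then show "\<beta>s \<in> ?L \<and> \<alpha>s \<in> ?L"
      using sub len by simp
  qed
  then show ?thesis
    using finite_lists_length_le[OF fin] by (meson finite_SigmaI finite_subset)
qed

lemma discrete_vector_field_arrows_disjoint:
  assumes "discrete_vector_field K F" "(a, b) \<in> F" "(c, d) \<in> F" "(a, b) \<noteq> (c, d)"
  shows "a \<noteq> c" "a \<noteq> d" "b \<noteq> c" "b \<noteq> d"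
proof -
  have arrows: "\<forall>x\<in>F. \<forall>y\<in>F. x \<noteq> y \<longrightarrow> {fst x, snd x} \<inter> {fst y, snd y} = {}"
    using assms(1) unfolding discrete_vector_field_def case_prod_unfold prod.collapse
    by (rule conjunct2)
  show "a \<noteq> c" "a \<noteq> d" "b \<noteq> c" "b \<noteq> d"
    using arrows[rule_format, OF assms(2-4)] by (simp_all add: disjoint_iff)
qed

section \<open>The new arrow and the paths at its two ends\<close>

context
  fixes K :: "'a simplex set" and F \<alpha> \<beta> p
  assumes acyclic_insert: "acyclic_discrete_vector_field K (insert (\<alpha>, \<beta>) F)"
    and new_arrow: "(\<alpha>, \<beta>) \<notin> F"
    and \<alpha>_simplex: "\<alpha> \<in> simplices K p"
    and \<beta>_simplex: "\<beta> \<in> simplices K (p + 1)"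
begin

lemma field_insert: "discrete_vector_field K (insert (\<alpha>, \<beta>) F)"
  using acyclic_insert by (simp add: acyclic_discrete_vector_field_def)

lemma arrow_at_new_simplices:
  assumes "(a, b) \<in> F"
  shows "a \<noteq> \<alpha>" "b \<noteq> \<beta>" "a \<noteq> \<beta>"
proof -
  have "(a, b) \<noteq> (\<alpha>, \<beta>)"
    using assms new_arrow by blast
  note disjoint =
    discrete_vector_field_arrows_disjoint[OF field_insert insertI2[OF assms] insertI1 this]
  show "a \<noteq> \<alpha>" "b \<noteq> \<beta>" "a \<noteq> \<beta>"
    by (fact disjoint)+
qed

text \<open>Every entry but the last is the tail of a step. By distinctness none of these is
  \<alpha>, so the new arrow is not followed.\<close>

lemma no_new_lower_path_to_tail:
  assumes path: "lower_path K (insert (\<alpha>, \<beta>) F) q \<alpha>s \<beta>s" and last: "last \<alpha>s = \<alpha>"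
  shows "lower_path K F q \<alpha>s \<beta>s"
proof -
  have len: "length \<alpha>s = Suc (length \<beta>s)"
    using path by (simp add: lower_path_def)
  then have "\<alpha>s ! length \<beta>s = \<alpha>"
    using last last_conv_nth[of \<alpha>s] by fastforce
  then have "\<alpha>s ! i \<noteq> \<alpha>" if "i < length \<beta>s" for i
    using distinct_lower_path[OF acyclic_insert path] that len
    by (metis lessI less_SucI nat_neq_iff nth_eq_iff_index_eq)
  then show ?thesis
    using path unfolding lower_path_def by blast
qed

lemma no_new_upper_path_to_tail:
  assumes path: "upper_path K (insert (\<alpha>, \<beta>) F) q \<beta>s \<alpha>s" and last: "last \<alpha>s = \<alpha>"
  shows "upper_path K F q \<beta>s \<alpha>s"
proof (rule ccontr)
  assume "\<not> upper_path K F q \<beta>s \<alpha>s"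
  with path obtain i where i: "i + 1 < length \<beta>s" "\<alpha>s ! i = \<alpha>"
    by (rule upper_path_insertE)
  have len: "length \<alpha>s = length \<beta>s" "\<alpha>s \<noteq> []"
    using path by (auto simp: upper_path_def)
  \<comment> \<open>\<alpha> is the last entry and also sits at position \<open>i\<close>, from
    which a further step is made; this contradicts distinctness.\<close>
  then have "\<alpha>s ! (length \<alpha>s - 1) = \<alpha>s ! i"
    using last i by (simp add: last_conv_nth)
  then have "length \<alpha>s - 1 = i"
    using i len nth_eq_iff_index_eq[OF distinct_upper_path[OF acyclic_insert path], of _ i] by simp
  then show False
    using i len by simp
qed

text \<open>The head of an arrow is never a tail in the same field, so only the trivial path starts
  at \<beta> as a lower simplex.\<close>

lemma no_new_lower_path_from_head:
  assumes path: "lower_path K (insert (\<alpha>, \<beta>) F) q \<alpha>s \<beta>s" and hd: "hd \<alpha>s = \<beta>"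
  shows "lower_path K F q \<alpha>s \<beta>s"
proof (cases "\<beta>s = []")
  case False
  have "\<alpha> \<noteq> \<beta>"
    using field_insert by (auto simp: discrete_vector_field_def)
  moreover have "(\<beta>, \<beta>s ! 0) \<in> insert (\<alpha>, \<beta>) F"
    using path hd False unfolding lower_path_def by (cases \<alpha>s) auto
  ultimately show ?thesis
    using arrow_at_new_simplices(3) by auto
qed (use path in \<open>auto simp: lower_path_def\<close>)

text \<open>Only the new arrow leaves \<alpha>, and following it would return to \<beta> at once,
  which paths exclude. The length bound sets aside the single face step from \<beta> to
  \<alpha>.\<close>

lemma upper_path_from_head_avoids_tail:
  assumes path: "upper_path K (insert (\<alpha>, \<beta>) F) q \<beta>s \<alpha>s" and hd: "hd \<beta>s = \<beta>"
    and len: "length \<beta>s > 1"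
  shows "hd \<alpha>s \<noteq> \<alpha>"
proof
  assume "hd \<alpha>s = \<alpha>"
  moreover have ne: "\<alpha>s \<noteq> []" "\<beta>s \<noteq> []"
    using path len unfolding upper_path_def by fastforce+
  ultimately have first: "\<alpha>s ! 0 = \<alpha>" "\<beta>s ! 0 = \<beta>"
    using hd by (simp_all add: hd_conv_nth)
  moreover have "(\<alpha>s ! 0, \<beta>s ! 1) \<in> insert (\<alpha>, \<beta>) F" "\<beta>s ! 0 \<noteq> \<beta>s ! 1"
    using path len unfolding upper_path_def by (metis add_0)+
  ultimately have "(\<alpha>, \<beta>s ! 1) \<in> F"
    by simp
  then show False
    using arrow_at_new_simplices(1) by blast
qed

text \<open>A path using the new arrow would reach \<alpha>; prefixing \<alpha> then gives a path
  that meets \<alpha> twice.\<close>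

lemma no_new_upper_path_from_head:
  assumes path: "upper_path K (insert (\<alpha>, \<beta>) F) q \<beta>s \<alpha>s" and hd: "hd \<beta>s = \<beta>"
  shows "upper_path K F q \<beta>s \<alpha>s"
proof (rule ccontr)
  assume "\<not> upper_path K F q \<beta>s \<alpha>s"
  with path obtain i where i: "i + 1 < length \<beta>s" "\<alpha>s ! i = \<alpha>"
    by (rule upper_path_insertE)
  then have mem: "\<alpha> \<in> set \<alpha>s" and "\<alpha> \<in> simplices K q"
    using path unfolding upper_path_def by (metis add_lessD1 nth_mem subsetD)+
  moreover have "hd \<alpha>s \<noteq> \<alpha>"
    using upper_path_from_head_avoids_tail[OF path hd] i by simp
  ultimately have "lower_path K (insert (\<alpha>, \<beta>) F) q (\<alpha> # \<alpha>s) \<beta>s"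
    using path hd by (intro lower_path_Cons_upper_path) auto
  then show False
    using distinct_lower_path[OF acyclic_insert] mem by fastforce
qed

section \<open>Joining and cutting paths at the new arrow\<close>

lemma upper_path_join:
  assumes path1: "upper_path K F q b1 a1" and last: "last a1 = \<alpha>" and "hd b1 \<noteq> \<beta>"
    and path2: "upper_path K F r b2 a2" and hd: "hd b2 = \<beta>" and "last a2 \<noteq> \<alpha>"
  shows "upper_path K (insert (\<alpha>, \<beta>) F) p (b1 @ b2) (a1 @ a2)"
proof -
  have nonempty: "a1 \<noteq> []" "b1 \<noteq> []" "a2 \<noteq> []" "b2 \<noteq> []"
    and len: "length a1 = length b1" "length a2 = length b2"
    using path1 path2 by (auto simp: upper_path_def)
  \<comment> \<open>The cardinalities of \<alpha> and \<beta> fix the dimension of both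
    pieces.\<close>
  have "\<alpha> \<in> simplices K q" "\<beta> \<in> simplices K (r + 1)"
    using path1 path2 last hd nonempty unfolding upper_path_def
    by (metis last_in_set subsetD, metis hd_in_set subsetD)
  then have "q = p" "r = p"
    using \<alpha>_simplex \<beta>_simplex by (auto simp: simplices_def)
  then have "upper_path K (insert (\<alpha>, \<beta>) F) p b1 a1" "upper_path K (insert (\<alpha>, \<beta>) F) p b2 a2"
    using path1 path2 upper_path_mono[OF _ subset_insertI] by auto
  \<comment> \<open>A single face step has \<open>hd a2 = last a2\<close>, which differs from
    \<alpha> by hypothesis.\<close>
  moreover have "\<alpha> \<noteq> hd a2"
  proof (cases "length b2 > 1")
    case True
    then show ?thesis
      using upper_path_from_head_avoids_tail[OF calculation(2) hd] by simp
  next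
    case False
    then have "length a2 = 1"
      using nonempty len by (cases b2) auto
    then show ?thesis
      using assms(6) by (auto simp: length_Suc_conv)
  qed
  \<comment> \<open>Either an arrow of \<open>F\<close> enters \<open>last b1\<close>, or
    \<open>last b1\<close> is the starting simplex \<open>hd b1\<close>.\<close>
  moreover have "last b1 \<noteq> \<beta>"
  proof (cases "length b1 > 1")
    case True
    \<comment> \<open>In the shifted numbering \<open>a1 ! i\<close> is the tail of the arrow into
      \<open>b1 ! (i + 1)\<close>, hence the 2.\<close>
    then have "(a1 ! (length b1 - 2), b1 ! (length b1 - 2 + 1)) \<in> F"
      using path1 unfolding upper_path_def by auto
    moreover have "length b1 - 2 + 1 = length b1 - 1"
      using True by simp
    ultimately show ?thesis
      using arrow_at_new_simplices(2) nonempty by (metis last_conv_nth)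
  next
    case False
    then show ?thesis
      using assms(3) nonempty by (cases b1) auto
  qed
  ultimately show ?thesis
    using last hd nonempty len by (subst upper_path_append) auto
qed

lemma upper_path_cut:
  assumes path: "upper_path K (insert (\<alpha>, \<beta>) F) q \<beta>s \<alpha>s" and "\<not> upper_path K F q \<beta>s \<alpha>s"
  obtains b1 a1 b2 a2 where "\<beta>s = b1 @ b2" "\<alpha>s = a1 @ a2"
    "upper_path K F q b1 a1" "last a1 = \<alpha>" "upper_path K F q b2 a2" "hd b2 = \<beta>"
proof -
  obtain i where i: "i + 1 < length \<beta>s" "\<alpha>s ! i = \<alpha>" "\<beta>s ! (i + 1) = \<beta>"
    using assms by (rule upper_path_insertE)
  \<comment> \<open>The cut separates the tail \<open>\<alpha>s ! i\<close> from the head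
    \<open>\<beta>s ! (i + 1)\<close> of the new arrow.\<close>
  let ?n = "i + 1"
  have len: "length \<alpha>s = length \<beta>s"
    using path by (simp add: upper_path_def)
  have nonempty: "length (take ?n \<alpha>s) = length (take ?n \<beta>s)" "take ?n \<beta>s \<noteq> []" "drop ?n \<beta>s \<noteq> []"
    using i len by auto
  have "upper_path K (insert (\<alpha>, \<beta>) F) q (take ?n \<beta>s @ drop ?n \<beta>s) (take ?n \<alpha>s @ drop ?n \<alpha>s)"
    using path by simp
  then have paths: "upper_path K (insert (\<alpha>, \<beta>) F) q (take ?n \<beta>s) (take ?n \<alpha>s)"
    "upper_path K (insert (\<alpha>, \<beta>) F) q (drop ?n \<beta>s) (drop ?n \<alpha>s)"
    unfolding upper_path_append[OF nonempty] by blast+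
  have ends: "last (take ?n \<alpha>s) = \<alpha>" "hd (drop ?n \<beta>s) = \<beta>"
    using i len by (simp_all add: take_Suc_conv_app_nth hd_drop_conv_nth)
  \<comment> \<open>So far the pieces are paths of the enlarged field; ending at \<alpha> or
    starting at \<beta> makes them paths of \<open>F\<close>.\<close>
  show thesis
    using that[of "take ?n \<beta>s" "drop ?n \<beta>s" "take ?n \<alpha>s" "drop ?n \<alpha>s"] ends
      no_new_upper_path_to_tail[OF paths(1)] no_new_upper_path_from_head[OF paths(2)]
    by simp
qed

section \<open>Uniqueness of the cut and the count\<close>

lemma upper_paths_hd_last:
  assumes "(bs, as) \<in> upper_paths K F \<tau> \<sigma>"
  shows "bs \<noteq> []" "length as = length bs" "hd bs = \<tau>" "last as = \<sigma>"
  using assms by (auto simp: upper_paths_def upper_path_def)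

lemma append_traverses_new_arrow:
  assumes "(b1, a1) \<in> upper_paths K F \<tau> \<alpha>" "(b2, a2) \<in> upper_paths K F \<beta> \<sigma>"
  shows "(a1 @ a2) ! (length b1 - 1) = \<alpha>" "(b1 @ b2) ! (length b1 - 1 + 1) = \<beta>"
    "length b1 - 1 + 1 < length (b1 @ b2)"
  using upper_paths_hd_last[OF assms(1)] upper_paths_hd_last[OF assms(2)]
    last_conv_nth[of a1] hd_conv_nth[of b2]
  by (simp_all add: nth_append flip: length_greater_0_conv)

text \<open>If the second cut came later, the first junction would lie inside the path
  \<open>(c1, d1)\<close> of \<open>F\<close>, putting the new arrow into \<open>F\<close>.\<close>

lemma cut_position_le:
  assumes "(b1, a1) \<in> upper_paths K F \<tau> \<alpha>" "(b2, a2) \<in> upper_paths K F \<beta> \<sigma>"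
    and "(c1, d1) \<in> upper_paths K F \<tau>' \<alpha>" "b1 @ b2 = c1 @ c2" "a1 @ a2 = d1 @ d2"
  shows "length c1 \<le> length b1"
proof (rule ccontr)
  let ?i = "length b1 - 1"
  assume "\<not> length c1 \<le> length b1"
  \<comment> \<open>As \<open>b1\<close> is nonempty, \<open>?i + 1\<close> equals
    \<open>length b1\<close>.\<close>
  then have i: "?i + 1 < length c1"
    using upper_paths_hd_last(1)[OF assms(1)] by (cases b1) auto
  obtain q where path: "upper_path K F q c1 d1"
    using assms(3) by (auto simp: upper_paths_def)
  have "d1 ! ?i = (d1 @ d2) ! ?i" "c1 ! (?i + 1) = (c1 @ c2) ! (?i + 1)"
    using i path by (auto simp: nth_append upper_path_def)
  then have "(\<alpha>, \<beta>) \<in> F"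
    using i path append_traverses_new_arrow[OF assms(1,2)] assms(4,5)
    unfolding upper_path_def by metis
  then show False
    using new_arrow by blast
qed

text \<open>Two decompositions of one path bound each other's cut position, so they cut at the same
  place.\<close>

lemma inj_on_join:
  "inj_on (\<lambda>((b1, a1), (b2, a2)). (b1 @ b2, a1 @ a2))
     (upper_paths K F \<tau> \<alpha> \<times> upper_paths K F \<beta> \<sigma>)"
    (is "inj_on ?join ?P")
proof (rule inj_onI)
  fix x y assume xy: "x \<in> ?P" "y \<in> ?P" and join: "?join x = ?join y"
  obtain b1 a1 b2 a2 c1 d1 c2 d2
    where x: "x = ((b1, a1), (b2, a2))" and y: "y = ((c1, d1), (c2, d2))"
    by (metis surj_pair)
  have paths: "(b1, a1) \<in> upper_paths K F \<tau> \<alpha>" "(b2, a2) \<in> upper_paths K F \<beta> \<sigma>"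
    "(c1, d1) \<in> upper_paths K F \<tau> \<alpha>" "(c2, d2) \<in> upper_paths K F \<beta> \<sigma>"
    and eq: "b1 @ b2 = c1 @ c2" "a1 @ a2 = d1 @ d2"
    using xy join unfolding x y by simp_all
  have "length b1 = length c1"
    using cut_position_le[OF paths(1,2,3) eq] cut_position_le[OF paths(3,4,1) eq[symmetric]]
    by simp
  moreover have "length a1 = length b1" "length d1 = length c1"
    by (rule paths[THEN upper_paths_hd_last(2)])+
  ultimately show "x = y"
    using eq unfolding x y by simp
qed

text \<open>Cutting gives one inclusion, joining the other. The hypotheses on \<tau> and \<sigma>
  exclude an immediate return at the junction when a piece is a single face step.\<close>

lemma upper_paths_insert:
  assumes "\<tau> \<noteq> \<beta>" "\<sigma> \<noteq> \<alpha>"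
  shows "upper_paths K (insert (\<alpha>, \<beta>) F) \<tau> \<sigma> =
     upper_paths K F \<tau> \<sigma> \<union>
     (\<lambda>((b1, a1), (b2, a2)). (b1 @ b2, a1 @ a2)) `
       (upper_paths K F \<tau> \<alpha> \<times> upper_paths K F \<beta> \<sigma>)"
    (is "?L = ?O \<union> ?join ` ?P")
proof
  show "?L \<subseteq> ?O \<union> ?join ` ?P"
  proof clarify
    fix \<beta>s \<alpha>s assume L: "(\<beta>s, \<alpha>s) \<in> ?L" and new: "(\<beta>s, \<alpha>s) \<notin> ?join ` ?P"
    then obtain q where path: "upper_path K (insert (\<alpha>, \<beta>) F) q \<beta>s \<alpha>s"
      and ends: "hd \<beta>s = \<tau>" "last \<alpha>s = \<sigma>"
      by (auto simp: upper_paths_def)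
    have "upper_path K F q \<beta>s \<alpha>s"
    proof (rule ccontr)
      assume "\<not> upper_path K F q \<beta>s \<alpha>s"
      with path obtain b1 a1 b2 a2 where cut: "\<beta>s = b1 @ b2" "\<alpha>s = a1 @ a2"
        "upper_path K F q b1 a1" "last a1 = \<alpha>" "upper_path K F q b2 a2" "hd b2 = \<beta>"
        by (rule upper_path_cut)
      then have "b1 \<noteq> []" "a2 \<noteq> []"
        by (auto simp: upper_path_def)
      then have "((b1, a1), (b2, a2)) \<in> ?P"
        using cut ends by (auto simp: upper_paths_def)
      then show False
        using new cut by force
    qed
    then show "(\<beta>s, \<alpha>s) \<in> ?O"
      using ends by (auto simp: upper_paths_def)
  qed
  have "?join ` ?P \<subseteq> ?L"
  proof clarify
    fix b1 a1 b2 a2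
    assume paths: "(b1, a1) \<in> upper_paths K F \<tau> \<alpha>" "(b2, a2) \<in> upper_paths K F \<beta> \<sigma>"
    obtain q r where "upper_path K F q b1 a1" "upper_path K F r b2 a2"
      using paths by (auto simp: upper_paths_def)
    then have "upper_path K (insert (\<alpha>, \<beta>) F) p (b1 @ b2) (a1 @ a2)"
      using upper_path_join paths[THEN upper_paths_hd_last(3)]
        paths[THEN upper_paths_hd_last(4)] assms by blast
    moreover have "a2 \<noteq> []"
      using upper_paths_hd_last[OF paths(2)] by auto
    ultimately show "(b1 @ b2, a1 @ a2) \<in> ?L"
      using upper_paths_hd_last[OF paths(1)] upper_paths_hd_last[OF paths(2)]
      by (auto simp: upper_paths_def)
  qed
  moreover have "?O \<subseteq> ?L"
    using upper_path_mono[OF _ subset_insertI] by (fastforce simp: upper_paths_def)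
  ultimately show "?O \<union> ?join ` ?P \<subseteq> ?L"
    by blast
qed

text \<open>A joined path follows the new arrow, which \<open>F\<close> lacks. This makes the union
  in \<open>upper_paths_insert\<close> disjoint.\<close>

lemma join_not_old_path:
  assumes "(b1, a1) \<in> upper_paths K F \<tau> \<alpha>" "(b2, a2) \<in> upper_paths K F \<beta> \<sigma>"
  shows "(b1 @ b2, a1 @ a2) \<notin> upper_paths K F \<tau>' \<sigma>'"
  using append_traverses_new_arrow[OF assms] new_arrow
  unfolding upper_paths_def upper_path_def by fastforce

text \<open>Joining is injective, so the paths gained are as many as the pairs; finiteness lets the
  cardinalities of the two disjoint sets add.\<close>

lemma num_paths_insert:
  assumes "finite K" "acyclic_discrete_vector_field K F" "\<tau> \<noteq> \<beta>" "\<sigma> \<noteq> \<alpha>"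
  shows "num_paths K (insert (\<alpha>, \<beta>) F) \<tau> \<sigma> =
     num_paths K F \<tau> \<sigma> + num_paths K F \<tau> \<alpha> * num_paths K F \<beta> \<sigma>"
proof -
  have num: "num_paths K G x y = card (upper_paths K G x y)" for G x y
    by (simp add: num_paths_def upper_paths_def)
  have fin: "finite (upper_paths K F x y)" for x y
    using assms by (intro finite_upper_paths)
  show ?thesis
    unfolding num upper_paths_insert[OF assms(3,4)]
    using join_not_old_path
    by (subst card_Un_disjoint)
      (auto simp: fin card_image[OF inj_on_join] card_cartesian_product)
qed

end

theorem proposition4p7:
  fixes K :: "'a simplex set"
    and F F' :: "('a simplex \<times> 'a simplex) set"
    and \<alpha> \<beta> :: "'a simplex"
    and p :: nat
  assumes "finite_simplicial_complex K"
    and "acyclic_discrete_vector_field K F"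
    and "\<alpha> \<in> simplices K p" and "\<beta> \<in> simplices K (p + 1)"
    and "added_naturally K F \<alpha> \<beta>"
    and "F' = F \<union> {(\<alpha>, \<beta>)}"
  shows "(\<forall>q \<alpha>s \<beta>s. lower_path K F' q \<alpha>s \<beta>s \<and> last \<alpha>s = \<alpha> \<longrightarrow> lower_path K F q \<alpha>s \<beta>s) \<and>
         (\<forall>q \<beta>s \<alpha>s. upper_path K F' q \<beta>s \<alpha>s \<and> last \<alpha>s = \<alpha> \<longrightarrow> upper_path K F q \<beta>s \<alpha>s) \<and>
         (\<forall>q \<alpha>s \<beta>s. lower_path K F' q \<alpha>s \<beta>s \<and> hd \<alpha>s = \<beta> \<longrightarrow> lower_path K F q \<alpha>s \<beta>s) \<and>
         (\<forall>q \<beta>s \<alpha>s. upper_path K F' q \<beta>s \<alpha>s \<and> hd \<beta>s = \<beta> \<longrightarrow> upper_path K F q \<beta>s \<alpha>s) \<and>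
         (\<forall>\<tau> \<in> simplices K (p + 1). \<forall>\<sigma> \<in> simplices K p. \<tau> \<noteq> \<beta> \<and> \<sigma> \<noteq> \<alpha> \<longrightarrow>
            num_paths K F' \<tau> \<sigma> = num_paths K F \<tau> \<sigma> + num_paths K F \<tau> \<alpha> * num_paths K F \<beta> \<sigma>)"
proof -
  have acyc: "acyclic_discrete_vector_field K (insert (\<alpha>, \<beta>) F)" and new: "(\<alpha>, \<beta>) \<notin> F"
    using assms(5) by (auto simp: added_naturally_def)
  note setting = acyc new assms(3,4)
  have "finite K"
    using assms(1) by (simp add: finite_simplicial_complex_def)
  then show ?thesis
    unfolding assms(6) Un_insert_right Un_empty_right
    using no_new_lower_path_to_tail[OF setting] no_new_upper_path_to_tail[OF setting]
      no_new_lower_path_from_head[OF setting] no_new_upper_path_from_head[OF setting]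
      num_paths_insert[OF setting _ assms(2)]
    by blast
qed

end
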